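(* Let $n,w,d\ge1$, $N=2^n$, and let $\mathbb{F}$ be a field with $|\mathbb{F}|>nd$. Let $F\in\mathbb{F}[X_1,\ldots,X_N]$ have individual degree at most $d$ and be computed by a commutative roABP of width $w$. Then $F\not\equiv0$ if and only if $F\circ\mathcal{G}^{\mathrm{SSV}}_{n,1+4\log w}\not\equiv0$.
   Context: Let $P(z_1,\ldots,z_n,x_1,\ldots,x_n)=\prod_{i=1}^n(z_ix_i+(1-z_i))$ and $Q^{\mathrm{SSV}}_{n,k}(y,z,x)=\sum_{j=1}^k y_jP(z_j,x)$ with $z_j=(z_{j,1},\ldots,z_{j,n})$; $\mathcal{G}^{\mathrm{SSV}}_{n,k}(y,z)$ is the coefficient vector of $Q^{\mathrm{SSV}}_{n,k}$ as a multilinear polynomial in $x$, with coordinates indexed by subsets $S\subseteq[n]$ and identified with $X_1,\ldots,X_N$ via $i-1=\sum_{k\in S}2^{k-1}$; $F\circ\mathcal{G}$ denotes substituting coordinate $i$ for $X_i$. A read-once oblivious algebraic branching program (roABP) of width $w$ in variable order $\sigma$ (a permutation of $[N]$) computes $F=\big(\prod_{i=1}^N M_i(X_{\sigma(i)})\big)_{1,1}$ where each $M_i$ is a $w\times w$ matrix whose entries are univariate polynomials in $X_{\sigma(i)}$. $F$ is computed by a width-$w$ commutative roABP if it is computed by a width-$w$ roABP in every variable order. Here $\log$ is base $2$ (taken so that $1+4\log w$ is an integer). *)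

theory Defs
  imports "HOL-Combinatorics.Permutations" "HOL-Library.Poly_Mapping" "HOL-Computational_Algebra.Polynomial"
begin

text \<open>Multivariate polynomials over a coefficient ring 'a in variables of type 'v:
  finitely supported maps from monomials (exponent vectors 'v =>0 nat) to coefficients.
  The ring structure is the convolution ring of HOL-Library.Poly_Mapping.\<close>

type_synonym ('v, 'a) mpoly = "('v \<Rightarrow>\<^sub>0 nat) \<Rightarrow>\<^sub>0 'a"

definition mmonom :: "'a::zero \<Rightarrow> ('v \<Rightarrow>\<^sub>0 nat) \<Rightarrow> ('v, 'a) mpoly" where
  "mmonom c m = Poly_Mapping.single m c"

definition mvar :: "'v \<Rightarrow> ('v, 'a::{zero,one}) mpoly" where
  "mvar v = Poly_Mapping.single (Poly_Mapping.single v 1) 1"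

definition mconst :: "'a::zero \<Rightarrow> ('v, 'a) mpoly" where
  "mconst c = Poly_Mapping.single 0 c"

definition indiv_deg_le :: "('v, 'a::zero) mpoly \<Rightarrow> nat \<Rightarrow> bool" where
  "indiv_deg_le F d \<longleftrightarrow> (\<forall>m \<in> Poly_Mapping.keys F. \<forall>v. Poly_Mapping.lookup m v \<le> d)"

definition upoly_in :: "'v \<Rightarrow> 'a::comm_ring_1 poly \<Rightarrow> ('v, 'a) mpoly" where
  "upoly_in v p = (\<Sum>e\<le>Polynomial.degree p. mconst (coeff p e) * mvar v ^ e)"

definition msubst :: "('v \<Rightarrow> ('u, 'a::comm_ring_1) mpoly) \<Rightarrow> ('v, 'a) mpoly \<Rightarrow> ('u, 'a) mpoly" where
  "msubst g F = (\<Sum>m \<in> Poly_Mapping.keys F.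
      mconst (Poly_Mapping.lookup F m) * (\<Prod>v \<in> Poly_Mapping.keys m. g v ^ Poly_Mapping.lookup m v))"

definition matmul :: "nat \<Rightarrow> (nat \<Rightarrow> nat \<Rightarrow> 'b::comm_semiring_1) \<Rightarrow> (nat \<Rightarrow> nat \<Rightarrow> 'b) \<Rightarrow> nat \<Rightarrow> nat \<Rightarrow> 'b" where
  "matmul w A B = (\<lambda>r c. \<Sum>k<w. A r k * B k c)"

definition matid :: "nat \<Rightarrow> nat \<Rightarrow> 'b::comm_semiring_1" where
  "matid = (\<lambda>r c. if r = c then 1 else 0)"

definition matprod :: "nat \<Rightarrow> (nat \<Rightarrow> nat \<Rightarrow> 'b::comm_semiring_1) list \<Rightarrow> nat \<Rightarrow> nat \<Rightarrow> 'b" where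
  "matprod w Ms = foldr (matmul w) Ms matid"

text \<open>F (in variables X_1..X_N, encoded as naturals 1..N) is computed by a width-w roABP in
  variable order sigma: F = (prod_{i=1}^N M_i(X_{sigma i}))_{1,1}, each M_i a w x w matrix of
  univariate polynomials in X_{sigma i}. Matrix indices are 0-based here, so entry (1,1) is (0,0).\<close>
definition roABP :: "nat \<Rightarrow> nat \<Rightarrow> (nat \<Rightarrow> nat) \<Rightarrow> (nat, 'a::comm_ring_1) mpoly \<Rightarrow> bool" where
  "roABP N w \<sigma> F \<longleftrightarrow>
     (\<exists>M :: nat \<Rightarrow> nat \<Rightarrow> nat \<Rightarrow> 'a poly.
        F = matprod w (map (\<lambda>i. \<lambda>r c. upoly_in (\<sigma> i) (M i r c)) [1..<N+1]) 0 0)"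

definition commutative_roABP :: "nat \<Rightarrow> nat \<Rightarrow> (nat, 'a::comm_ring_1) mpoly \<Rightarrow> bool" where
  "commutative_roABP N w F \<longleftrightarrow> (\<forall>\<sigma>. \<sigma> permutes {1..N} \<longrightarrow> roABP N w \<sigma> F)"

datatype gvar = Y nat | Z nat nat

text \<open>Subset S of [n] corresponding to the coordinate index i in {1..N}: i - 1 = sum_{k in S} 2^(k-1).\<close>
definition subset_of_index :: "nat \<Rightarrow> nat \<Rightarrow> nat set" where
  "subset_of_index n i = {k \<in> {1..n}. odd ((i - 1) div 2 ^ (k - 1))}"

text \<open>Coefficient of prod_{i in S} x_i in Q^SSV_{n,k}(y,z,x) = sum_j y_j prod_i (z_{j,i} x_i + 1 - z_{j,i}).\<close>
definition SSV_coord :: "nat \<Rightarrow> nat \<Rightarrow> nat set \<Rightarrow> (gvar, 'a::comm_ring_1) mpoly" where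
  "SSV_coord n k S = (\<Sum>j = 1..k. mvar (Y j) *
      ((\<Prod>i \<in> S. mvar (Z j i)) * (\<Prod>i \<in> {1..n} - S. 1 - mvar (Z j i))))"

definition SSV_gen :: "nat \<Rightarrow> nat \<Rightarrow> nat \<Rightarrow> (gvar, 'a::comm_ring_1) mpoly" where
  "SSV_gen n k i = SSV_coord n k (subset_of_index n i)"

end

theory Submission
  imports Defs "Jordan_Normal_Form.Matrix"
begin

text \<open>
  With \<open>L = \<lceil>log w\<rceil>\<close> and \<open>l = 2L\<close>, the generator is split into a block of \<open>m = l + 1\<close> summands,
  giving a point \<open>\<alpha>\<close>, and a block of \<open>l\<close> summands, which can turn any \<open>l\<close> coordinates of \<open>\<alpha>\<close> into
  arbitrary values. So if the composition vanishes, \<open>F\<close> vanishes at \<open>\<alpha>\<close> with any \<open>l\<close> coordinates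
  replaced by free variables.

  If \<open>F \<noteq> 0\<close>, take a minimal set \<open>T\<close> of coordinates that can be freed without making \<open>F\<close> vanish; it
  contains a set \<open>T'\<close> of size \<open>m\<close>. The resulting nonzero polynomial vanishes under each substitution
  \<open>x\<^sub>i := \<alpha>\<^sub>i\<close>, \<open>i \<in> T'\<close>, and reading the variables in \<open>T'\<close> first shows that its coefficient matrix,
  with the monomials in the \<open>x\<^sub>i\<close>, \<open>i \<in> T'\<close>, as rows, has rank at most \<open>w\<close>. Moving the \<open>j\<close>-th
  \<open>z\<close>-vector of the first block to \<open>\<chi>\<^sub>j + t z\<^sub>j\<close>, where \<open>\<chi>\<^sub>j\<close> is the indicator vector of the \<open>j\<close>-th
  element of \<open>T'\<close>, and keeping only the lowest order in \<open>t\<close> turns the \<open>\<alpha>\<^sub>i\<close>, \<open>i \<in> T'\<close>, into distinct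
  variables \<open>y\<^sub>i\<close> without raising the rank. For a polynomial vanishing on the diagonals \<open>x\<^sub>i = y\<^sub>i\<close>,
  a block of top degree in \<open>x\<^sub>i\<close> and \<open>y\<^sub>i\<close> is accompanied by a second one on its antidiagonal, so
  every \<open>i\<close> doubles the size of a triangular minor. Hence \<open>2\<^sup>m \<le> w\<close>, a contradiction.
\<close>

abbreviation "lookup \<equiv> Poly_Mapping.lookup"
abbreviation "keys \<equiv> Poly_Mapping.keys"
abbreviation "single \<equiv> Poly_Mapping.single"
abbreviation "update \<equiv> Poly_Mapping.update"

section \<open>Substitution\<close>

lemma sum_single_lookup:
  fixes F :: "'v \<Rightarrow>\<^sub>0 'a::comm_monoid_add"
  shows "(\<Sum>m\<in>keys F. single m (lookup F m)) = F"
  by (rule poly_mapping_eqI)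
     (auto simp: lookup_sum lookup_single when_def in_keys_iff)

lemma poly_mapping_single_add_induct [case_names single add]:
  fixes F :: "'v \<Rightarrow>\<^sub>0 'a::comm_monoid_add"
  assumes single: "\<And>m a. P (single m a)" and add: "\<And>F G. P F \<Longrightarrow> P G \<Longrightarrow> P (F + G)"
  shows "P F"
proof -
  have "P (\<Sum>m\<in>A. single m (lookup F m))" for A
    by (induction A rule: infinite_finite_induct)
       (use single[of _ 0] in \<open>auto intro: single add\<close>)
  then show ?thesis
    using sum_single_lookup[of F] by metis
qed

definition monom_subst :: "('v \<Rightarrow> 'r::comm_ring_1) \<Rightarrow> ('v \<Rightarrow>\<^sub>0 nat) \<Rightarrow> 'r" where
  "monom_subst g m = (\<Prod>v\<in>keys m. g v ^ lookup m v)"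

lemma monom_subst_superset:
  assumes "finite A" "keys m \<subseteq> A"
  shows "monom_subst g m = (\<Prod>v\<in>A. g v ^ lookup m v)"
  unfolding monom_subst_def using assms
  by (intro prod.mono_neutral_left) (auto simp: in_keys_iff)

lemma monom_subst_0 [simp]: "monom_subst g 0 = 1"
  by (simp add: monom_subst_def)

lemma monom_subst_single [simp]: "monom_subst g (single v e) = g v ^ e"
  by (subst monom_subst_superset[of "{v}"]) auto

lemma monom_subst_add: "monom_subst g (m + m') = monom_subst g m * monom_subst g m'"
proof -
  let ?A = "keys m \<union> keys m'"
  have "keys (m + m') \<subseteq> ?A"
    by (rule Poly_Mapping.keys_add)
  then show ?thesis
    by (simp add: monom_subst_superset[of ?A] lookup_add power_add prod.distrib)
qed

lemma msubst_superset:
  assumes "finite B" "keys F \<subseteq> B"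
  shows "msubst g F = (\<Sum>m\<in>B. mconst (lookup F m) * monom_subst g m)"
  unfolding msubst_def monom_subst_def using assms
  by (intro sum.mono_neutral_left) (auto simp: in_keys_iff mconst_def)

lemma msubst_single: "msubst g (single m a) = mconst a * monom_subst g m"
  by (subst msubst_superset[of "{m}"]) auto

lemma msubst_add: "msubst g (F + G) = msubst g F + msubst g G"
proof -
  let ?B = "keys F \<union> keys G"
  have "keys (F + G) \<subseteq> ?B"
    by (rule Poly_Mapping.keys_add)
  then show ?thesis
    by (simp add: msubst_superset[of ?B] mconst_def lookup_add single_add distrib_right
        sum.distrib)
qed

lemma msubst_mult:
  fixes F G :: "('v, 'a::comm_ring_1) mpoly" and g :: "'v \<Rightarrow> ('u, 'a) mpoly"
  shows "msubst g (F * G) = msubst g F * msubst g G"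
proof (induction F rule: poly_mapping_single_add_induct)
  case (single m a)
  show ?case
  proof (induction G rule: poly_mapping_single_add_induct)
    case (single m' b)
    have "(mconst (a * b) :: ('u, 'a) mpoly) = mconst a * mconst b"
      by (simp add: mconst_def mult_single)
    then show ?case
      by (simp add: mult_single msubst_single monom_subst_add mult_ac)
  qed (simp add: distrib_left msubst_add)
qed (simp add: distrib_right msubst_add)

interpretation msubst: comm_ring_hom "msubst g" for g
proof
  show "msubst g 0 = 0"
    by (simp add: msubst_def)
  show "msubst g 1 = 1"
    unfolding single_one[symmetric] by (subst msubst_single) (simp add: mconst_def)
qed (fact msubst_add msubst_mult)+

lemma msubst_mconst [simp]: "msubst g (mconst a) = mconst a"
  by (simp add: mconst_def msubst_single)

lemma msubst_mvar [simp]: "msubst g (mvar v) = g v"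
  by (simp add: mvar_def msubst_single mconst_def)

lemma mvar_power: "mvar v ^ e = single (single v e) 1"
  by (induction e) (simp_all add: mvar_def mult_single flip: single_add)

lemma monom_subst_mvar: "monom_subst mvar m = (single m 1 :: ('v, 'a::comm_ring_1) mpoly)"
proof -
  have "(\<Prod>v\<in>A. mvar v ^ lookup m v) =
      (single (\<Sum>v\<in>A. single v (lookup m v)) 1 :: ('v, 'a) mpoly)" for A
    by (induction A rule: infinite_finite_induct) (simp_all add: mvar_power mult_single)
  then show ?thesis
    by (simp add: monom_subst_def sum_single_lookup)
qed

lemma msubst_mvar_id [simp]: "msubst mvar F = F"
  by (induction F rule: poly_mapping_single_add_induct)
     (simp_all add: msubst_single monom_subst_mvar mconst_def mult_single msubst_add)

lemma msubst_msubst: "msubst g (msubst h F) = msubst (\<lambda>v. msubst g (h v)) F"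
  by (induction F rule: poly_mapping_single_add_induct)
     (simp_all add: msubst_single msubst_add monom_subst_def hom_distribs)

section \<open>Variables\<close>

definition mvars :: "('v, 'a::zero) mpoly \<Rightarrow> 'v set" where
  "mvars F = (\<Union>m\<in>keys F. keys m)"

abbreviation zero_outside :: "'v set \<Rightarrow> ('v, 'a::comm_ring_1) mpoly \<Rightarrow> ('v, 'a) mpoly" where
  "zero_outside S \<equiv> msubst (\<lambda>v. if v \<in> S then mvar v else 0)"

lemma lookup_zero_outside:
  fixes F :: "('v, 'a::comm_ring_1) mpoly"
  shows "lookup (zero_outside S F) m = (if keys m \<subseteq> S then lookup F m else 0)"
proof (induction F rule: poly_mapping_single_add_induct)
  case (single m' a)
  have "monom_subst (\<lambda>v. if v \<in> S then mvar v else 0) m' =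
      (if keys m' \<subseteq> S then single m' 1 else 0 :: ('v, 'a) mpoly)"
  proof (cases "keys m' \<subseteq> S")
    case True
    then show ?thesis
      unfolding monom_subst_mvar[symmetric] by (auto simp: monom_subst_def intro!: prod.cong)
  next
    case False
    then obtain v where "v \<in> keys m'" "v \<notin> S"
      by blast
    then show ?thesis
      using False
      by (auto simp: monom_subst_def in_keys_iff zero_power intro!: prod_zero bexI[of _ v])
  qed
  then show ?case
    by (simp add: msubst_single mconst_def mult_single lookup_single when_def)
qed (simp add: msubst_add lookup_add)

lemma mvars_subset_iff: "mvars F \<subseteq> S \<longleftrightarrow> zero_outside S F = F"
proof
  assume "mvars F \<subseteq> S"
  then show "zero_outside S F = F"
    by (intro poly_mapping_eqI)
      (auto simp: lookup_zero_outside mvars_def UN_subset_iff in_keys_iff[of _ F])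
next
  assume "zero_outside S F = F"
  then have "lookup F m = 0" if "\<not> keys m \<subseteq> S" for m
    using that lookup_zero_outside[of S F m] by simp
  then show "mvars F \<subseteq> S"
    by (auto simp: mvars_def in_keys_iff)
qed

lemma msubst_cong:
  assumes "\<And>v. v \<in> mvars F \<Longrightarrow> g v = g' v"
  shows "msubst g F = msubst g' F"
  unfolding msubst_def
  by (intro sum.cong refl arg_cong2[of _ _ _ _ "(*)"] prod.cong arg_cong2[of _ _ _ _ "(^)"] assms)
     (auto simp: mvars_def)

lemma msubst_mvar_upd_idle: "v \<notin> mvars F \<Longrightarrow> msubst (mvar(v := A)) F = F"
  by (rule trans[OF msubst_cong msubst_mvar_id]) auto

lemma mvars_mvar [simp]: "mvars (mvar v :: ('v, 'a::zero_neq_one) mpoly) = {v}"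
  by (simp add: mvars_def mvar_def)

lemma mvars_msubst_subset:
  assumes "\<And>v. v \<in> mvars F \<Longrightarrow> mvars (g v) \<subseteq> S"
  shows "mvars (msubst g F) \<subseteq> S"
  using assms unfolding mvars_subset_iff msubst_msubst by (rule msubst_cong)

lemma mvars_mult_subset:
  fixes F G :: "('v, 'a::comm_ring_1) mpoly"
  shows "mvars F \<subseteq> S \<Longrightarrow> mvars G \<subseteq> S \<Longrightarrow> mvars (F * G) \<subseteq> S"
  by (simp add: mvars_subset_iff hom_distribs)

lemma mvars_sum_subset:
  fixes f :: "'i \<Rightarrow> ('v, 'a::comm_ring_1) mpoly"
  shows "(\<And>i. i \<in> I \<Longrightarrow> mvars (f i) \<subseteq> S) \<Longrightarrow> mvars (sum f I) \<subseteq> S"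
  by (simp add: mvars_subset_iff hom_distribs)

section \<open>Separation rank\<close>

definition mrestrict :: "'v set \<Rightarrow> ('v \<Rightarrow>\<^sub>0 nat) \<Rightarrow> ('v \<Rightarrow>\<^sub>0 nat)" where
  "mrestrict S m = Poly_Mapping.mapp (\<lambda>v e. e when v \<in> S) m"

lemma lookup_mrestrict: "lookup (mrestrict S m) v = (if v \<in> S then lookup m v else 0)"
  by (auto simp: mrestrict_def lookup_mapp when_def in_keys_iff)

definition mmerge :: "'v set \<Rightarrow> ('v \<Rightarrow>\<^sub>0 nat) \<Rightarrow> ('v \<Rightarrow>\<^sub>0 nat) \<Rightarrow> ('v \<Rightarrow>\<^sub>0 nat)" where
  "mmerge S b a = mrestrict S b + mrestrict (- S) a"

lemma lookup_mmerge: "lookup (mmerge S b a) v = (if v \<in> S then lookup b v else lookup a v)"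
  by (simp add: mmerge_def lookup_add lookup_mrestrict)

lemma mmerge_same [simp]: "mmerge S m m = m"
  by (rule poly_mapping_eqI) (simp add: lookup_mmerge)

lemma add_eq_mmerge_iff:
  assumes "keys m \<subseteq> S" "keys m' \<inter> S = {}"
  shows "m + m' = mmerge S b a \<longleftrightarrow> m = mrestrict S b \<and> m' = mrestrict (- S) a"
proof
  assume eq: "m + m' = mmerge S b a"
  have "lookup m v = (if v \<in> S then lookup b v else 0)"
    "lookup m' v = (if v \<in> S then 0 else lookup a v)" for v
  proof -
    have "v \<notin> S \<Longrightarrow> lookup m v = 0" "v \<in> S \<Longrightarrow> lookup m' v = 0"
      using assms by (auto simp: in_keys_iff)
    then show "lookup m v = (if v \<in> S then lookup b v else 0)"
      "lookup m' v = (if v \<in> S then 0 else lookup a v)"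
      using arg_cong[OF eq, of "\<lambda>m. lookup m v"]
      by (auto simp: lookup_add lookup_mmerge split: if_splits)
  qed
  then show "m = mrestrict S b \<and> m' = mrestrict (- S) a"
    by (auto intro!: poly_mapping_eqI simp: lookup_mrestrict)
qed (simp add: mmerge_def)

definition coeff_matrix ::
    "'v set \<Rightarrow> ('v, 'a::zero) mpoly \<Rightarrow> ('v \<Rightarrow>\<^sub>0 nat) \<Rightarrow> ('v \<Rightarrow>\<^sub>0 nat) \<Rightarrow> 'a" where
  "coeff_matrix S F b a = lookup F (mmerge S b a)"

lemma coeff_matrix_mult:
  fixes G H :: "('v, 'a::comm_ring_1) mpoly"
  assumes "mvars G \<subseteq> S" "mvars H \<inter> S = {}"
  shows "coeff_matrix S (G * H) b a = lookup G (mrestrict S b) * lookup H (mrestrict (- S) a)"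
proof -
  have disjoint: "keys m \<subseteq> S" "keys m' \<inter> S = {}" if "m \<in> keys G" "m' \<in> keys H" for m m'
    using assms that by (auto simp: mvars_def)
  have "G * H = (\<Sum>m\<in>keys G. \<Sum>m'\<in>keys H. single (m + m') (lookup G m * lookup H m'))"
    using arg_cong2[OF sum_single_lookup[of G] sum_single_lookup[of H], of "(*)"]
    by (simp add: sum_product mult_single)
  then have "coeff_matrix S (G * H) b a = (\<Sum>m\<in>keys G. \<Sum>m'\<in>keys H.
      lookup G m * lookup H m' when m + m' = mmerge S b a)"
    by (simp add: coeff_matrix_def lookup_sum lookup_single)
  also have "\<dots> = (\<Sum>m\<in>keys G. \<Sum>m'\<in>keys H.
      (lookup G m when m = mrestrict S b) * (lookup H m' when m' = mrestrict (- S) a))"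
    by (intro sum.cong refl) (simp add: add_eq_mmerge_iff[OF disjoint] when_def)
  also have "\<dots> = (\<Sum>m\<in>keys G. lookup G m when m = mrestrict S b) *
      (\<Sum>m'\<in>keys H. lookup H m' when m' = mrestrict (- S) a)"
    by (simp add: sum_product)
  also have "\<dots> = lookup G (mrestrict S b) * lookup H (mrestrict (- S) a)"
    by (simp add: when_def sum.delta in_keys_iff)
  finally show ?thesis .
qed

definition separation_rank_le :: "'v set \<Rightarrow> nat \<Rightarrow> ('v, 'a::comm_ring_1) mpoly \<Rightarrow> bool" where
  "separation_rank_le S w F \<longleftrightarrow>
    (\<exists>u v. \<forall>b a. coeff_matrix S F b a = (\<Sum>k<w. u b k * v a k))"

lemma separation_rank_le_sum_mult:
  assumes "\<And>k. mvars (g k) \<subseteq> S" "\<And>k. mvars (h k) \<inter> S = {}"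
  shows "separation_rank_le S w (\<Sum>k<w. g k * h k)"
proof -
  have "coeff_matrix S (\<Sum>k<w. g k * h k) b a =
      (\<Sum>k<w. lookup (g k) (mrestrict S b) * lookup (h k) (mrestrict (- S) a))" for b a
    unfolding coeff_matrix_mult[OF assms, symmetric] by (simp add: coeff_matrix_def lookup_sum)
  then show ?thesis
    unfolding separation_rank_le_def
    by (intro exI[of _ "\<lambda>b k. lookup (g k) (mrestrict S b)"]
        exI[of _ "\<lambda>a k. lookup (h k) (mrestrict (- S) a)"]) blast
qed

lemma separation_rank_le_zero_outside:
  assumes "separation_rank_le S w F"
  shows "separation_rank_le S w (zero_outside U F)"
proof -
  obtain u v where uv: "\<And>b a. coeff_matrix S F b a = (\<Sum>k<w. u b k * v a k)"
    using assms unfolding separation_rank_le_def by blast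
  have "keys (mmerge S b a) \<subseteq> U \<longleftrightarrow> keys b \<inter> S \<subseteq> U \<and> keys a - S \<subseteq> U" for b a
    by (auto simp: in_keys_iff lookup_mmerge subset_iff)
  then have "coeff_matrix S (zero_outside U F) b a = (\<Sum>k<w.
      (if keys b \<inter> S \<subseteq> U then u b k else 0) * (if keys a - S \<subseteq> U then v a k else 0))" for b a
    using uv[of b a]
    by (cases "keys b \<inter> S \<subseteq> U"; cases "keys a - S \<subseteq> U")
       (simp_all add: coeff_matrix_def lookup_zero_outside)
  then show ?thesis
    unfolding separation_rank_le_def
    by (intro exI[of _ "\<lambda>b k. if keys b \<inter> S \<subseteq> U then u b k else 0"]
        exI[of _ "\<lambda>a k. if keys a - S \<subseteq> U then v a k else 0"]) blast
qed

section \<open>Factoring out a power of a variable\<close>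

lemma lookup_mvar_power_mult:
  fixes G :: "('v, 'a::comm_ring_1) mpoly"
  shows "lookup (mvar v ^ e * G) m = (if e \<le> lookup m v then lookup G (m - single v e) else 0)"
proof (induction G rule: poly_mapping_single_add_induct)
  case (single m' a)
  have "single v e + m' = m \<longleftrightarrow> e \<le> lookup m v \<and> m' = m - single v e"
  proof safe
    assume "e \<le> lookup m v"
    then show "single v e + (m - single v e) = m"
      by (intro poly_mapping_eqI) (auto simp: lookup_add lookup_minus lookup_single when_def)
  qed (auto simp: lookup_add)
  then show ?case
    by (auto simp: mvar_power mult_single lookup_single when_def)
qed (simp add: distrib_left lookup_add)

lemma lookup_mvar_power_mult_add:
  fixes G :: "('v, 'a::comm_ring_1) mpoly"
  shows "lookup (mvar v ^ e * G) (m + single v e) = lookup G m"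
  by (simp add: lookup_mvar_power_mult lookup_add)

lemma mvar_power_mult_eq_0_iff:
  fixes G :: "('v, 'a::comm_ring_1) mpoly"
  shows "mvar v ^ e * G = 0 \<longleftrightarrow> G = 0"
proof
  assume "mvar v ^ e * G = 0"
  then show "G = 0"
    by (intro poly_mapping_eqI) (metis lookup_mvar_power_mult_add lookup_zero)
qed simp

lemma factor_out_mvar:
  fixes F :: "('v, 'a::comm_ring_1) mpoly"
  assumes "F \<noteq> 0"
  obtains e G where "F = mvar v ^ e * G" "zero_outside (- {v}) G \<noteq> 0"
proof -
  obtain m where m: "m \<in> keys F" and min: "\<And>m'. m' \<in> keys F \<Longrightarrow> lookup m v \<le> lookup m' v"
    using assms ex_has_least_nat[of "\<lambda>m. m \<in> keys F" _ "\<lambda>m. lookup m v"]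
    by (metis keys_eq_empty ex_in_conv)
  define e where "e = lookup m v"
  define G where "G = Poly_Mapping.map_key (\<lambda>m. m + single v e) F"
  have lookup_G: "lookup G m' = lookup F (m' + single v e)" for m'
    by (simp add: G_def map_key.rep_eq inj_def)
  have sub_add: "m' - single v e + single v e = m'" if "e \<le> lookup m' v" for m'
    using that
    by (intro poly_mapping_eqI) (auto simp: lookup_add lookup_minus lookup_single when_def)
  have "lookup F m' = lookup (mvar v ^ e * G) m'" for m'
    using min[of m']
    by (auto simp: lookup_mvar_power_mult lookup_G sub_add in_keys_iff simp flip: e_def)
  then have "F = mvar v ^ e * G"
    by (rule poly_mapping_eqI)
  moreover have "lookup (zero_outside (- {v}) G) (m - single v e) = lookup F m"
    unfolding lookup_zero_outside lookup_G
    by (simp add: sub_add in_keys_iff lookup_minus subset_Compl_singleton flip: e_def)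
  then have "zero_outside (- {v}) G \<noteq> 0"
    using m by (auto simp: in_keys_iff)
  ultimately show ?thesis
    by (rule that)
qed

lemma separation_rank_le_mvar_power_cancel:
  fixes G :: "('v, 'a::comm_ring_1) mpoly"
  assumes "separation_rank_le S w (mvar v ^ e * G)" "v \<notin> S"
  shows "separation_rank_le S w G"
proof -
  obtain x y where xy: "\<And>b a. coeff_matrix S (mvar v ^ e * G) b a = (\<Sum>k<w. x b k * y a k)"
    using assms(1) unfolding separation_rank_le_def by blast
  have "coeff_matrix S G b a = (\<Sum>k<w. x b k * y (a + single v e) k)" for b a
  proof -
    have "mmerge S b (a + single v e) = mmerge S b a + single v e"
      using assms(2)
      by (auto intro!: poly_mapping_eqI simp: lookup_mmerge lookup_add lookup_single when_def)
    then show ?thesis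
      using xy[of b "a + single v e"] by (simp add: coeff_matrix_def lookup_mvar_power_mult_add)
  qed
  then show ?thesis
    unfolding separation_rank_le_def
    by (intro exI[of _ x] exI[of _ "\<lambda>a. y (a + single v e)"]) blast
qed

section \<open>Triangular minors\<close>

definition triangular_minor :: "('i \<Rightarrow> 'j \<Rightarrow> 'a::zero) \<Rightarrow> ('i \<times> 'j) list \<Rightarrow> bool" where
  "triangular_minor M ps \<longleftrightarrow>
    (\<forall>(i, j)\<in>set ps. M i j \<noteq> 0) \<and> sorted_wrt (\<lambda>(_, j) (i, _). M i j = 0) ps"

lemma triangular_minor_Cons:
  "triangular_minor M ((i, j) # ps) \<longleftrightarrow>
    M i j \<noteq> 0 \<and> (\<forall>(i', _)\<in>set ps. M i' j = 0) \<and> triangular_minor M ps"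
  by (auto simp: triangular_minor_def)

lemma triangular_minor_append:
  "triangular_minor M (ps @ qs) \<longleftrightarrow> triangular_minor M ps \<and> triangular_minor M qs \<and>
    (\<forall>(_, j)\<in>set ps. \<forall>(i, _)\<in>set qs. M i j = 0)"
  by (auto simp: triangular_minor_def sorted_wrt_append)

lemma triangular_minor_map:
  "triangular_minor M (map (map_prod f g) ps) \<longleftrightarrow> triangular_minor (\<lambda>i j. M (f i) (g j)) ps"
  by (auto simp: triangular_minor_def sorted_wrt_map case_prod_unfold)

lemma triangular_minor_two_blocks:
  assumes "triangular_minor (\<lambda>i j. M (f i) (g j)) ps"
    and "triangular_minor (\<lambda>i j. M (f' i) (g' j)) qs"
    and "\<And>i j. M (f' i) (g j) = 0"
  shows "triangular_minor M (map (map_prod f g) ps @ map (map_prod f' g') qs)"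
  using assms by (auto simp: triangular_minor_append triangular_minor_map)

lemma triangular_minor_same_zeros:
  assumes "triangular_minor M ps"
    and "\<And>i j. i \<in> fst ` set ps \<Longrightarrow> M' i j = 0 \<longleftrightarrow> M i j = 0"
  shows "triangular_minor M' ps"
  using assms unfolding triangular_minor_def
  by (auto intro!: sorted_wrt_mono_rel[of ps "\<lambda>(_, j) (i, _). M i j = 0"] simp: rev_image_eqI)

lemma length_triangular_minor_le:
  fixes x :: "'i \<Rightarrow> 'k \<Rightarrow> 'a::idom" and y :: "'j \<Rightarrow> 'k \<Rightarrow> 'a"
  assumes "finite K" "triangular_minor (\<lambda>i j. \<Sum>k\<in>K. x i k * y j k) ps"
  shows "length ps \<le> card K"
  using assms
proof (induction ps arbitrary: K y)
  case (Cons p ps)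
  obtain i0 j0 where p: "p = (i0, j0)"
    by fastforce
  have pivot: "(\<Sum>k\<in>K. x i0 k * y j0 k) \<noteq> 0"
    and orthogonal: "\<And>i. i \<in> fst ` set ps \<Longrightarrow> (\<Sum>k\<in>K. x i k * y j0 k) = 0"
    and minor: "triangular_minor (\<lambda>i j. \<Sum>k\<in>K. x i k * y j k) ps"
    using Cons.prems(2) by (auto simp: p triangular_minor_Cons)
  obtain k0 where k0: "k0 \<in> K" "y j0 k0 \<noteq> 0"
    using pivot by (rule sum.not_neutral_contains_not_neutral) auto
  define y' where "y' j k = y j0 k0 * y j k - y j k0 * y j0 k" for j k
  have "(\<Sum>k\<in>K - {k0}. x i k * y' j k) = y j0 k0 * (\<Sum>k\<in>K. x i k * y j k)"
    if "i \<in> fst ` set ps" for i j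
  proof -
    have "(\<Sum>k\<in>K - {k0}. x i k * y' j k) = (\<Sum>k\<in>K. x i k * y' j k)"
      using \<open>finite K\<close> k0(1) by (simp add: sum.remove[of K k0] y'_def)
    also have "\<dots> = y j0 k0 * (\<Sum>k\<in>K. x i k * y j k) - y j k0 * (\<Sum>k\<in>K. x i k * y j0 k)"
      by (simp add: y'_def right_diff_distrib sum_subtractf sum_distrib_left mult_ac)
    finally show ?thesis
      by (simp add: orthogonal[OF that])
  qed
  then have "triangular_minor (\<lambda>i j. \<Sum>k\<in>K - {k0}. x i k * y' j k) ps"
    using k0(2) by (intro triangular_minor_same_zeros[OF minor]) auto
  then have "length ps \<le> card (K - {k0})"
    using Cons.IH \<open>finite K\<close> by blast
  then show ?case
    using card_Suc_Diff1[OF \<open>finite K\<close> k0(1)] by simp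
qed simp

lemma update_same [simp]: "update k (lookup f k) f = f"
  by (rule poly_mapping_eqI) (simp add: lookup_update)

lemma update_commute: "k \<noteq> l \<Longrightarrow> update k a (update l b f) = update l b (update k a f)"
  by (rule poly_mapping_eqI) (auto simp: lookup_update)

lemma vanishing_sum_two_nonzero:
  fixes f :: "nat \<Rightarrow> 'a::comm_monoid_add"
  assumes "(\<Sum>t\<le>s. f t) = 0" "t0 \<le> s" "f t0 \<noteq> 0"
  obtains t1 t2 where "t1 < t2" "t2 \<le> s" "f t1 \<noteq> 0" "f t2 \<noteq> 0"
proof -
  have "\<exists>t\<le>s. t \<noteq> t0 \<and> f t \<noteq> 0"
  proof (rule ccontr)
    assume "\<not> ?thesis"
    then have "(\<Sum>t\<le>s. f t) = (\<Sum>t\<in>{t0}. f t)"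
      using assms(2) by (intro sum.mono_neutral_right) auto
    with assms show False
      by simp
  qed
  then show ?thesis
    using assms(2,3) that by (metis nat_neq_iff)
qed

text \<open>An antidiagonal of top degree carries at least two nonzero blocks, and pairing the larger
  exponent of \<open>x\<close> with the larger exponent of \<open>y\<close> exceeds the top degree.\<close>

lemma two_blocks_of_vanishing_antidiagonals:
  fixes M :: "('v \<Rightarrow>\<^sub>0 nat) \<Rightarrow> ('u \<Rightarrow>\<^sub>0 nat) \<Rightarrow> 'a::comm_monoid_add"
  assumes antidiagonal: "\<And>b a s. (\<Sum>t\<le>s. M (update x t b) (update y (s - t) a)) = 0"
    and bounded: "\<And>b a. M b a \<noteq> 0 \<Longrightarrow> lookup b x + lookup a y \<le> D"
    and "M b0 a0 \<noteq> 0"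
  shows "\<exists>t t' r r'. (\<exists>b a. M (update x t b) (update y r a) \<noteq> 0) \<and>
    (\<exists>b a. M (update x t' b) (update y r' a) \<noteq> 0) \<and> (\<forall>b a. M (update x t' b) (update y r a) = 0)"
proof -
  let ?deg = "\<lambda>b a. lookup b x + lookup a y"
  obtain b a where ba: "M b a \<noteq> 0" and maximal: "\<And>b' a'. M b' a' \<noteq> 0 \<Longrightarrow> ?deg b' a' \<le> ?deg b a"
    using ex_has_greatest_nat[of "\<lambda>(b, a). M b a \<noteq> 0" "(b0, a0)" "\<lambda>(b, a). ?deg b a" "Suc D"]
      bounded \<open>M b0 a0 \<noteq> 0\<close> by (auto simp: less_Suc_eq_le)
  define s where "s = ?deg b a"
  have "lookup b x \<le> s" "M (update x (lookup b x) b) (update y (s - lookup b x) a) \<noteq> 0"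
    using ba by (simp_all add: s_def)
  then obtain t t' where t: "t < t'" "t' \<le> s"
    and nonzero: "M (update x t b) (update y (s - t) a) \<noteq> 0"
      "M (update x t' b) (update y (s - t') a) \<noteq> 0"
    by (rule vanishing_sum_two_nonzero[OF antidiagonal])
  have "M (update x t' b) (update y (s - t) a) = 0" for b a
  proof (rule ccontr)
    assume "M (update x t' b) (update y (s - t) a) \<noteq> 0"
    then have "t' + (s - t) \<le> s"
      using maximal unfolding s_def by (metis lookup_update)
    with t show False
      by simp
  qed
  with nonzero show ?thesis
    by metis
qed

lemma triangular_minor_of_vanishing_antidiagonals:
  fixes M :: "('v \<Rightarrow>\<^sub>0 nat) \<Rightarrow> ('u \<Rightarrow>\<^sub>0 nat) \<Rightarrow> 'a::comm_monoid_add"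
  assumes "finite I" "inj_on x I" "inj_on y I"
    and "\<And>i b a s. i \<in> I \<Longrightarrow> (\<Sum>t\<le>s. M (update (x i) t b) (update (y i) (s - t) a)) = 0"
    and "\<And>i b a. i \<in> I \<Longrightarrow> M b a \<noteq> 0 \<Longrightarrow> lookup b (x i) + lookup a (y i) \<le> D"
    and "M b0 a0 \<noteq> 0"
  shows "\<exists>ps. triangular_minor M ps \<and> length ps = 2 ^ card I"
  using assms
proof (induction I arbitrary: M b0 a0 rule: finite_induct)
  case empty
  then show ?case
    by (intro exI[of _ "[(b0, a0)]"]) (simp add: triangular_minor_def)
next
  case (insert i I)
  note antidiagonal = insert.prems(3) and bounded = insert.prems(4)
  define block where "block t r b a = M (update (x i) t b) (update (y i) r a)" for t r b a
  have block_minor: "\<exists>ps. triangular_minor (block t r) ps \<and> length ps = 2 ^ card I"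
    if "block t r b a \<noteq> 0" for t r b a
  proof (rule insert.IH[of "block t r" b a, OF _ _ _ _ that])
    show "inj_on x I" "inj_on y I"
      using insert.prems(1,2) by auto
    fix j b a
    assume j: "j \<in> I"
    then have neq: "x i \<noteq> x j" "y i \<noteq> y j"
      using insert.prems(1,2) insert.hyps(2) by (auto simp: inj_on_def)
    show "(\<Sum>t'\<le>s. block t r (update (x j) t' b) (update (y j) (s - t') a)) = 0" for s
      using antidiagonal[of j] j by (simp add: block_def neq[THEN update_commute])
    show "lookup b (x j) + lookup a (y j) \<le> D" if "block t r b a \<noteq> 0"
      using bounded[of j, OF _ that[unfolded block_def]] j neq by (simp add: lookup_update)
  qed
  obtain t t' r r' where "\<exists>b a. block t r b a \<noteq> 0" "\<exists>b a. block t' r' b a \<noteq> 0"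
    and off_diagonal: "\<forall>b a. M (update (x i) t' b) (update (y i) r a) = 0"
    using two_blocks_of_vanishing_antidiagonals
      [of M "x i" "y i" D b0 a0, OF antidiagonal bounded insert.prems(5)]
    unfolding block_def by blast
  then obtain ps ps' where ps: "triangular_minor (block t r) ps" "length ps = 2 ^ card I"
    and ps': "triangular_minor (block t' r') ps'" "length ps' = 2 ^ card I"
    using block_minor by metis
  have "triangular_minor M (map (map_prod (update (x i) t) (update (y i) r)) ps @
      map (map_prod (update (x i) t') (update (y i) r')) ps')" (is "triangular_minor M ?qs")
    using ps(1) ps'(1) off_diagonal unfolding block_def
    by (intro triangular_minor_two_blocks) auto
  moreover have "length ?qs = 2 ^ card (insert i I)"
    using ps(2) ps'(2) insert.hyps by simp
  ultimately show ?case
    by blast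
qed

section \<open>Polynomials vanishing on diagonals\<close>

lemma monom_subst_mvar_upd:
  "monom_subst (mvar(x := mvar y)) m =
    (single (update x 0 m + single y (lookup m x)) 1 :: ('v, 'a::comm_ring_1) mpoly)"
proof -
  have "m = update x 0 m + single x (lookup m x)"
    by (rule poly_mapping_eqI) (simp add: lookup_add lookup_update lookup_single when_def)
  then have "monom_subst (mvar(x := mvar y)) m =
      monom_subst (mvar(x := mvar y)) (update x 0 m) * (mvar y ^ lookup m x :: ('v, 'a) mpoly)"
    by (metis fun_upd_same monom_subst_add monom_subst_single)
  also have "monom_subst (mvar(x := mvar y)) (update x 0 m) =
      (monom_subst mvar (update x 0 m) :: ('v, 'a) mpoly)"
    by (auto simp: monom_subst_def keys_update intro!: prod.cong)
  finally show ?thesis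
    by (simp only: monom_subst_mvar mvar_power mult_single mult_1)
qed

lemma eq_update_update_iff:
  fixes m m' :: "'v \<Rightarrow>\<^sub>0 nat"
  assumes "x \<noteq> y" "t \<le> s"
  shows "m' = update x t (update y (s - t) m) \<longleftrightarrow>
    t = lookup m' x \<and> update x 0 m' + single y (lookup m' x) = update x 0 (update y s m)"
proof (intro iffI conjI)
  assume eq: "m' = update x t (update y (s - t) m)"
  show "t = lookup m' x"
    by (simp add: eq lookup_update)
  show "update x 0 m' + single y (lookup m' x) = update x 0 (update y s m)"
    using assms
    by (intro poly_mapping_eqI) (auto simp: eq lookup_update lookup_add lookup_single when_def)
next
  assume "t = lookup m' x \<and> update x 0 m' + single y (lookup m' x) = update x 0 (update y s m)"
  then have t: "t = lookup m' x"
    and eq: "update x 0 m' + single y (lookup m' x) = update x 0 (update y s m)"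
    by auto
  show "m' = update x t (update y (s - t) m)"
  proof (rule poly_mapping_eqI)
    fix v
    show "lookup m' v = lookup (update x t (update y (s - t) m)) v"
      using arg_cong[OF eq, of "\<lambda>m. lookup m v"] assms(1) t
      by (auto simp: lookup_update lookup_add lookup_single when_def split: if_splits)
  qed
qed

lemma lookup_msubst_mvar_upd:
  fixes F :: "('v, 'a::comm_ring_1) mpoly"
  assumes "x \<noteq> y"
  shows "lookup (msubst (mvar(x := mvar y)) F) (update x 0 (update y s m)) =
    (\<Sum>t\<le>s. lookup F (update x t (update y (s - t) m)))"
proof (induction F rule: poly_mapping_single_add_induct)
  case (single m' c)
  let ?E = "update x 0 m' + single y (lookup m' x) = update x 0 (update y s m)"
  have "lookup m' x \<le> s" if ?E
    using arg_cong[OF that, of "\<lambda>m. lookup m y"] assms by (simp add: lookup_add lookup_update)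
  then have "(c when ?E) = (\<Sum>t\<le>s. if t = lookup m' x then c when ?E else 0)"
    by (auto simp: when_def)
  also have "\<dots> = (\<Sum>t\<le>s. lookup (single m' c) (update x t (update y (s - t) m)))"
    using assms by (intro sum.cong refl) (auto simp: lookup_single when_def eq_update_update_iff)
  finally show ?case
    unfolding msubst_single monom_subst_mvar_upd
    by (simp add: mconst_def mult_single lookup_single)
qed (simp add: msubst_add lookup_add sum.distrib)

lemma sum_coeff_matrix_antidiagonal:
  fixes F :: "('v, 'a::comm_ring_1) mpoly"
  assumes "x \<in> S" "y \<notin> S"
  shows "(\<Sum>t\<le>s. coeff_matrix S F (update x t b) (update y (s - t) a)) =
    lookup (msubst (mvar(x := mvar y)) F) (update x 0 (update y s (mmerge S b a)))"
proof -
  have neq: "x \<noteq> y"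
    using assms by blast
  have "mmerge S (update x t b) (update y r a) = update x t (update y r (mmerge S b a))" for t r
    using assms by (intro poly_mapping_eqI) (auto simp: lookup_mmerge lookup_update)
  then show ?thesis
    unfolding lookup_msubst_mvar_upd[OF neq] by (simp add: coeff_matrix_def)
qed

lemma two_power_card_le_of_vanishing_on_diagonals:
  fixes F :: "('v, 'a::idom) mpoly"
  assumes "F \<noteq> 0" "separation_rank_le (x ` I) w F"
    and I: "finite I" "inj_on x I" "inj_on y I" "x ` I \<inter> y ` I = {}"
    and vanish: "\<And>i. i \<in> I \<Longrightarrow> msubst (mvar(x i := mvar (y i))) F = 0"
  shows "2 ^ card I \<le> w"
proof -
  let ?M = "coeff_matrix (x ` I) F"
  have "finite (\<Union>i\<in>I. (\<lambda>m. lookup m (x i) + lookup m (y i)) ` keys F)"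
    using I(1) by simp
  then obtain D where D: "\<And>i m. i \<in> I \<Longrightarrow> m \<in> keys F \<Longrightarrow> lookup m (x i) + lookup m (y i) \<le> D"
    unfolding finite_nat_set_iff_bounded_le by blast
  obtain m where "m \<in> keys F"
    using \<open>F \<noteq> 0\<close> by (metis keys_eq_empty ex_in_conv)
  have "\<exists>ps. triangular_minor ?M ps \<and> length ps = 2 ^ card I"
  proof (rule triangular_minor_of_vanishing_antidiagonals[OF I(1-3)])
    fix i b a
    assume i: "i \<in> I"
    then have y: "y i \<notin> x ` I"
      using I(4) by auto
    show "(\<Sum>t\<le>s. ?M (update (x i) t b) (update (y i) (s - t) a)) = 0" for s
      using sum_coeff_matrix_antidiagonal[of "x i" "x ` I" "y i" F] i y vanish[OF i] by simp
    show "lookup b (x i) + lookup a (y i) \<le> D" if "?M b a \<noteq> 0"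
      using D[OF i, of "mmerge (x ` I) b a"] that i y
      by (simp add: coeff_matrix_def in_keys_iff lookup_mmerge)
  next
    show "?M m m \<noteq> 0"
      using \<open>m \<in> keys F\<close> by (simp add: coeff_matrix_def in_keys_iff)
  qed
  then obtain ps where ps: "triangular_minor ?M ps" "length ps = 2 ^ card I"
    by blast
  obtain u v where "\<forall>b a. ?M b a = (\<Sum>k<w. u b k * v a k)"
    using assms(2) unfolding separation_rank_le_def by blast
  then have "?M = (\<lambda>b a. \<Sum>k<w. u b k * v a k)"
    by blast
  with ps show ?thesis
    using length_triangular_minor_le[of "{..<w}" u v ps] by simp
qed

lemma two_power_card_le_of_vanishing_on_deformed_diagonals:
  fixes F :: "('v, 'a::idom) mpoly"
  assumes "F \<noteq> 0" "separation_rank_le (x ` I) w F"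
    and I: "finite I" "inj_on x I" "inj_on y I" "x ` I \<inter> y ` I = {}" and t: "t \<notin> x ` I"
    and vanish: "\<And>i. i \<in> I \<Longrightarrow> msubst (mvar(x i := A i)) F = 0"
    and deform: "\<And>i. i \<in> I \<Longrightarrow> zero_outside (- {t}) (A i) = mvar (y i)"
  shows "2 ^ card I \<le> w"
proof -
  obtain e G where F: "F = mvar t ^ e * G" and G: "zero_outside (- {t}) G \<noteq> 0"
    using factor_out_mvar[OF \<open>F \<noteq> 0\<close>] by blast
  have "msubst (mvar(x i := mvar (y i))) (zero_outside (- {t}) G) = 0" if i: "i \<in> I" for i
  proof -
    have "x i \<noteq> t"
      using i t by blast
    then have "mvar t ^ e * msubst (mvar(x i := A i)) G = 0"
      using vanish[OF i] by (simp add: F hom_distribs)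
    then have "zero_outside (- {t}) (msubst (mvar(x i := A i)) G) = 0"
      by (simp add: mvar_power_mult_eq_0_iff)
    also have "zero_outside (- {t}) (msubst (mvar(x i := A i)) G) =
        msubst (mvar(x i := mvar (y i))) (zero_outside (- {t}) G)"
      unfolding msubst_msubst using deform[OF i] \<open>x i \<noteq> t\<close> by (intro msubst_cong) auto
    finally show ?thesis .
  qed
  moreover have "separation_rank_le (x ` I) w (zero_outside (- {t}) G)"
    using separation_rank_le_mvar_power_cancel[OF assms(2)[unfolded F] t]
    by (rule separation_rank_le_zero_outside)
  ultimately show ?thesis
    by (intro two_power_card_le_of_vanishing_on_diagonals[OF G _ I])
qed

section \<open>Read-once branching programs\<close>

lemma matprod_append:
  assumes "r < w"
  shows "matprod w (xs @ ys) r c = (\<Sum>k<w. matprod w xs r k * matprod w ys k c)"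
  using assms
proof (induction xs arbitrary: r)
  case Nil
  have "(\<Sum>k<w. matprod w [] r k * matprod w ys k c) =
      (\<Sum>k<w. if k = r then matprod w ys k c else 0)"
    by (intro sum.cong) (auto simp: matprod_def matid_def)
  with Nil show ?case
    by simp
next
  case (Cons x xs)
  have "matprod w ((x # xs) @ ys) r c = (\<Sum>j<w. x r j * matprod w (xs @ ys) j c)"
    by (simp add: matprod_def matmul_def)
  also have "\<dots> = (\<Sum>j<w. \<Sum>k<w. x r j * (matprod w xs j k * matprod w ys k c))"
    using Cons.IH by (simp add: sum_distrib_left)
  also have "\<dots> = (\<Sum>k<w. \<Sum>j<w. x r j * (matprod w xs j k * matprod w ys k c))"
    by (rule sum.swap)
  also have "\<dots> = (\<Sum>k<w. matprod w (x # xs) r k * matprod w ys k c)"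
    by (simp add: matprod_def matmul_def sum_distrib_right mult.assoc)
  finally show ?case .
qed

lemma mvars_upoly_in_subset: "mvars (upoly_in v p) \<subseteq> {v}"
  by (simp add: mvars_subset_iff upoly_in_def hom_distribs)

lemma mvars_matprod_subset:
  fixes Ms :: "(nat \<Rightarrow> nat \<Rightarrow> ('v, 'a::comm_ring_1) mpoly) list"
  assumes "\<And>M i j. M \<in> set Ms \<Longrightarrow> mvars (M i j) \<subseteq> S"
  shows "mvars (matprod w Ms r c) \<subseteq> S"
  using assms
proof (induction Ms arbitrary: r)
  case Nil
  show ?case
    by (simp add: mvars_subset_iff matprod_def matid_def)
next
  case (Cons M Ms)
  have "matprod w (M # Ms) r c = (\<Sum>k<w. M r k * matprod w Ms k c)"
    by (simp add: matprod_def matmul_def)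
  with Cons show ?case
    by (simp add: mvars_sum_subset mvars_mult_subset)
qed

lemma permutation_with_initial_segment:
  assumes "T \<subseteq> {1..N}"
  obtains \<sigma> where "\<sigma> permutes {1..N}" "\<sigma> ` {1..card T} = T"
proof -
  have "finite T"
    using assms finite_subset by blast
  have card_le: "card T \<le> N"
    using card_mono[OF _ assms] by simp
  obtain f where f: "bij_betw f {1..card T} T"
    using ex_bij_betw_nat_finite_1[OF \<open>finite T\<close>] by blast
  have "card {card T + 1..N} = card ({1..N} - T)"
    using assms \<open>finite T\<close> by (simp add: card_Diff_subset)
  then obtain g where g: "bij_betw g {card T + 1..N} ({1..N} - T)"
    by (metis finite_Diff finite_atLeastAtMost finite_same_card_bij)
  define \<sigma> where
    "\<sigma> i = (if i \<in> {1..card T} then f i else if i \<in> {card T + 1..N} then g i else i)" for i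
  have image: "bij_betw \<sigma> {1..card T} T"
    using f by (subst bij_betw_cong[of _ \<sigma> f]) (auto simp: \<sigma>_def)
  moreover have "bij_betw \<sigma> {card T + 1..N} ({1..N} - T)"
    using g by (subst bij_betw_cong[of _ \<sigma> g]) (auto simp: \<sigma>_def)
  ultimately have "bij_betw \<sigma> ({1..card T} \<union> {card T + 1..N}) (T \<union> ({1..N} - T))"
    by (rule bij_betw_combine) auto
  moreover have "{1..card T} \<union> {card T + 1..N} = {1..N}" "T \<union> ({1..N} - T) = {1..N}"
    using card_le assms by auto
  ultimately have "\<sigma> permutes {1..N}"
    using card_le by (intro bij_imp_permutes) (auto simp: \<sigma>_def)
  with image show ?thesis
    using that by (auto simp: bij_betw_def)
qed

lemma roABP_factorization:
  assumes "roABP N w \<sigma> F" "w \<ge> 1" "n \<le> N"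
  shows "\<exists>g h. F = (\<Sum>k<w. g k * h k) \<and>
    (\<forall>k. mvars (g k) \<subseteq> \<sigma> ` {1..n} \<and> mvars (h k) \<subseteq> \<sigma> ` {n + 1..N})"
proof -
  obtain M where F: "F = matprod w (map (\<lambda>i r c. upoly_in (\<sigma> i) (M i r c)) [1..<N + 1]) 0 0"
    using assms(1) unfolding roABP_def by blast
  define P where "P xs = matprod w (map (\<lambda>i r c. upoly_in (\<sigma> i) (M i r c)) xs)" for xs
  have mvars_P: "mvars (P [a..<b + 1] r c) \<subseteq> \<sigma> ` {a..b}" for a b r c
    unfolding P_def by (rule mvars_matprod_subset) (auto dest!: subsetD[OF mvars_upoly_in_subset])
  have "[1..<N + 1] = [1..<n + 1] @ [n + 1..<N + 1]"
    using upt_add_eq_append[of 1 "n + 1" "N - n"] assms(3) by simp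
  then have "F = (\<Sum>k<w. P [1..<n + 1] 0 k * P [n + 1..<N + 1] k 0)"
    using assms(2) by (simp add: F P_def matprod_append)
  then show ?thesis
    by (intro exI[of _ "P [1..<n + 1] 0"] exI[of _ "\<lambda>k. P [n + 1..<N + 1] k 0"]
        conjI allI mvars_P)
qed

lemma commutative_roABP_factorization:
  assumes "commutative_roABP N w F" "w \<ge> 1" and T: "T \<subseteq> {1..N}"
  shows "\<exists>g h. F = (\<Sum>k<w. g k * h k) \<and> (\<forall>k. mvars (g k) \<subseteq> T \<and> mvars (h k) \<subseteq> {1..N} - T)"
proof -
  obtain \<sigma> where \<sigma>: "\<sigma> permutes {1..N}" "\<sigma> ` {1..card T} = T"
    using permutation_with_initial_segment[OF T] by blast
  have "card T \<le> N"
    using card_mono[OF _ T] by simp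
  have "\<sigma> ` {card T + 1..N} = \<sigma> ` ({1..N} - {1..card T})"
    by (rule arg_cong[of _ _ "image \<sigma>"]) auto
  also have "\<dots> = \<sigma> ` {1..N} - \<sigma> ` {1..card T}"
    by (rule image_set_diff[OF permutes_inj[OF \<sigma>(1)]])
  also have "\<dots> = {1..N} - T"
    using \<sigma> by (simp add: permutes_image)
  finally have "\<sigma> ` {card T + 1..N} = {1..N} - T" .
  moreover have "roABP N w \<sigma> F"
    using assms(1) \<sigma>(1) by (simp add: commutative_roABP_def)
  ultimately show ?thesis
    using roABP_factorization[of N w \<sigma> F "card T"] assms(2) \<sigma>(2) \<open>card T \<le> N\<close> by simp
qed

lemma commutative_roABP_mvars_subset:
  assumes "commutative_roABP N w F" "w \<ge> 1"
  shows "mvars F \<subseteq> {1..N}"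
proof -
  obtain g h where F: "F = (\<Sum>k<w. g k * h k)"
    and "\<forall>k. mvars (g k) \<subseteq> {1..N} \<and> mvars (h k) \<subseteq> {1..N} - {1..N}"
    using commutative_roABP_factorization[OF assms order_refl] by blast
  then show ?thesis
    unfolding F by (intro mvars_sum_subset mvars_mult_subset) auto
qed

section \<open>The generator\<close>

lemma inj_on_subset_of_index: "inj_on (subset_of_index n) {1..2 ^ n}"
proof (rule inj_onI)
  fix i j assume ij: "i \<in> {1..2 ^ n}" "j \<in> {1..2 ^ n}"
    and eq: "subset_of_index n i = subset_of_index n j"
  have high_bit: "\<not> odd (x div 2 ^ k)" if "x < 2 ^ n" "n \<le> k" for x k :: nat
    using that by (metis div_less dvd_0_right less_le_trans one_le_numeral power_increasing)
  have "odd ((i - 1) div 2 ^ k) = odd ((j - 1) div 2 ^ k)" for k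
  proof (cases "k < n")
    case True
    then have "Suc k \<in> subset_of_index n i \<longleftrightarrow> Suc k \<in> subset_of_index n j"
      using eq by simp
    with True show ?thesis
      by (simp add: subset_of_index_def)
  next
    case False
    then show ?thesis
      using ij high_bit[of "i - 1" k] high_bit[of "j - 1" k] by auto
  qed
  then have "i - 1 = j - 1"
    by (intro bit_eqI) (simp add: bit_iff_odd)
  with ij show "i = j"
    by auto
qed

lemma prod_of_bool_mult_prod_Diff:
  assumes "S \<subseteq> B" "S' \<subseteq> B" "finite B"
  shows "(\<Prod>l\<in>S. of_bool (l \<in> S')) * (\<Prod>l\<in>B - S. 1 - of_bool (l \<in> S')) =
    (of_bool (S = S') :: 'a::comm_ring_1)"
proof (cases "S = S'")
  case False
  have "finite S"
    using assms finite_subset by blast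
  from False consider l where "l \<in> S" "l \<notin> S'" | l where "l \<in> B - S" "l \<in> S'"
    using assms by blast
  then show ?thesis
  proof cases
    case 1
    then have "(\<Prod>l\<in>S. of_bool (l \<in> S')) = (0 :: 'a)"
      using \<open>finite S\<close> by (intro prod_zero) auto
    with False show ?thesis
      by simp
  next
    case 2
    then have "(\<Prod>l\<in>B - S. 1 - of_bool (l \<in> S')) = (0 :: 'a)"
      using assms(3) by (intro prod_zero) auto
    with False show ?thesis
      by simp
  qed
qed simp

definition SSV_eval :: "nat \<Rightarrow> nat \<Rightarrow> (nat \<Rightarrow> 'r::comm_ring_1) \<Rightarrow> (nat \<Rightarrow> nat \<Rightarrow> 'r) \<Rightarrow> nat \<Rightarrow> 'r" where
  "SSV_eval n k y z i = (\<Sum>j = 1..k. y j *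
    ((\<Prod>l\<in>subset_of_index n i. z j l) * (\<Prod>l\<in>{1..n} - subset_of_index n i. 1 - z j l)))"

lemma SSV_gen_eq_SSV_eval: "SSV_gen n k = SSV_eval n k (\<lambda>j. mvar (Y j)) (\<lambda>j l. mvar (Z j l))"
  by (rule ext) (simp add: SSV_gen_def SSV_coord_def SSV_eval_def)

lemma msubst_SSV_eval:
  "msubst g (SSV_eval n k y z i) = SSV_eval n k (\<lambda>j. msubst g (y j)) (\<lambda>j l. msubst g (z j l)) i"
  by (simp add: SSV_eval_def hom_distribs)

lemma SSV_eval_cong:
  assumes "\<And>j. j \<in> {1..k} \<Longrightarrow> y j = y' j" "\<And>j l. j \<in> {1..k} \<Longrightarrow> z j l = z' j l"
  shows "SSV_eval n k y z i = SSV_eval n k y' z' i"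
  unfolding SSV_eval_def using assms by (intro sum.cong) auto

lemma SSV_eval_add:
  "SSV_eval n (k + k') y z i =
    SSV_eval n k y z i + SSV_eval n k' (\<lambda>j. y (k + j)) (\<lambda>j. z (k + j)) i"
proof -
  have "sum f {1..k + k'} = sum f {1..k} + (\<Sum>j = 1..k'. f (k + j))" for f :: "nat \<Rightarrow> 'a"
    using sum.ub_add_nat[of 1 k f k'] sum.shift_bounds_cl_nat_ivl[of f 1 k k']
    by (simp add: add.commute)
  then show ?thesis
    by (simp add: SSV_eval_def)
qed

text \<open>At the indicator vector \<open>z\<close> of a subset, the product of the factors \<open>z\<^sub>l x\<^sub>l + 1 - z\<^sub>l\<close> is the
  monomial of that subset.\<close>

lemma SSV_eval_indicators:
  assumes "s ` {1..k} \<subseteq> {1..2 ^ n}" "i \<in> {1..2 ^ n}"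
  shows "SSV_eval n k y (\<lambda>j l. of_bool (l \<in> subset_of_index n (s j))) i =
    (\<Sum>j\<in>{j \<in> {1..k}. s j = i}. y j)"
proof -
  have index: "subset_of_index n i = subset_of_index n (s j) \<longleftrightarrow> s j = i" if "j \<in> {1..k}" for j
  proof -
    have "s j \<in> {1..2 ^ n}"
      using assms(1) that by blast
    then show ?thesis
      using inj_on_eq_iff[OF inj_on_subset_of_index assms(2)] by auto
  qed
  have "subset_of_index n i \<subseteq> {1..n}" for i
    by (auto simp: subset_of_index_def)
  then have "SSV_eval n k y (\<lambda>j l. of_bool (l \<in> subset_of_index n (s j))) i =
      (\<Sum>j = 1..k. if s j = i then y j else 0)"
    unfolding SSV_eval_def by (intro sum.cong refl) (simp add: prod_of_bool_mult_prod_Diff index)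
  also have "\<dots> = (\<Sum>j\<in>{j \<in> {1..k}. s j = i}. y j)"
    by (rule sum.inter_filter[symmetric]) simp
  finally show ?thesis .
qed

lemma SSV_eval_interpolation:
  fixes f :: "nat \<Rightarrow> 'r::comm_ring_1"
  assumes "T \<subseteq> {1..2 ^ n}" "card T \<le> k"
  shows "\<exists>y z. \<forall>i\<in>{1..2 ^ n}. SSV_eval n k y z i = (if i \<in> T then f i else 0)"
proof -
  have "finite T"
    using assms(1) finite_subset by blast
  then obtain s where s: "bij_betw s {1..card T} T"
    using ex_bij_betw_nat_finite_1 by blast
  define s' where "s' j = (if j \<in> {1..card T} then s j else 1)" for j
  define y where "y j = (if j \<in> {1..card T} then f (s j) else 0)" for j
  have "SSV_eval n k y (\<lambda>j l. of_bool (l \<in> subset_of_index n (s' j))) i =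
      (if i \<in> T then f i else 0)"
    if i: "i \<in> {1..2 ^ n}" for i
  proof -
    have "s' ` {1..k} \<subseteq> {1..2 ^ n}"
      using s assms(1) by (auto simp: s'_def bij_betw_def)
    then have "SSV_eval n k y (\<lambda>j l. of_bool (l \<in> subset_of_index n (s' j))) i =
        (\<Sum>j\<in>{j \<in> {1..k}. s' j = i}. y j)"
      using i by (rule SSV_eval_indicators)
    also have "\<dots> = (\<Sum>j\<in>{1..card T}. if s j = i then f i else 0)"
      using assms(2) by (intro sum.mono_neutral_cong) (auto simp: s'_def y_def)
    also have "\<dots> = (\<Sum>v\<in>T. if v = i then f i else 0)"
      by (rule sum.reindex_bij_betw[OF s])
    finally show ?thesis
      using \<open>finite T\<close> by simp
  qed
  then show ?thesis
    by blast
qed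

lemma msubst_SSV_gen_replace_coordinates_eq_0:
  fixes F :: "(nat, 'a::comm_ring_1) mpoly"
  assumes "msubst (SSV_gen n (k + k')) F = 0" "mvars F \<subseteq> {1..2 ^ n}"
    and T: "T \<subseteq> {1..2 ^ n}" "card T \<le> k'"
  shows "msubst (\<lambda>i. if i \<in> T then f i else SSV_gen n k i) F = 0"
proof -
  obtain y z where yz: "\<forall>i\<in>{1..2 ^ n}.
      SSV_eval n k' y z i = (if i \<in> T then f i - SSV_gen n k i else 0)"
    using SSV_eval_interpolation[OF T, of "\<lambda>i. f i - SSV_gen n k i"] by blast
  define \<theta> where "\<theta> v = (case v of
      Y j \<Rightarrow> if j \<le> k then mvar (Y j) else y (j - k)
    | Z j l \<Rightarrow> if j \<le> k then mvar (Z j l) else z (j - k) l)" for v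
  have \<theta>: "msubst \<theta> (SSV_gen n (k + k') i) = SSV_gen n k i + SSV_eval n k' y z i" for i
  proof -
    have "msubst \<theta> (SSV_gen n (k + k') i) =
        SSV_eval n k (\<lambda>j. \<theta> (Y j)) (\<lambda>j l. \<theta> (Z j l)) i +
        SSV_eval n k' (\<lambda>j. \<theta> (Y (k + j))) (\<lambda>j l. \<theta> (Z (k + j) l)) i"
      by (simp add: SSV_gen_eq_SSV_eval msubst_SSV_eval SSV_eval_add hom_distribs)
    also have "\<dots> = SSV_gen n k i + SSV_eval n k' y z i"
      unfolding SSV_gen_eq_SSV_eval
      by (intro arg_cong2[of _ _ _ _ "(+)"] SSV_eval_cong) (auto simp: \<theta>_def)
    finally show ?thesis .
  qed
  have "0 = msubst \<theta> (msubst (SSV_gen n (k + k')) F)"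
    by (simp add: assms(1))
  also have "\<dots> = msubst (\<lambda>i. if i \<in> T then f i else SSV_gen n k i) F"
    unfolding msubst_msubst using assms(2)
    by (intro msubst_cong) (use yz in \<open>auto simp: \<theta>\<close>)
  finally show ?thesis
    by simp
qed

text \<open>The generator only uses the variables \<open>Y j\<close> and \<open>Z j l\<close> with \<open>j \<ge> 1\<close>. So \<open>Z 0 i\<close> can serve
  as a free variable in place of the coordinate \<open>i\<close>, and \<open>Y 0\<close> as the deformation parameter \<open>t\<close>.\<close>

definition free_coordinates ::
    "nat set \<Rightarrow> (nat \<Rightarrow> (gvar, 'a::comm_ring_1) mpoly) \<Rightarrow> nat \<Rightarrow> (gvar, 'a) mpoly" where
  "free_coordinates T \<alpha> = (\<lambda>i. if i \<in> T then mvar (Z 0 i) else \<alpha> i)"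

definition SSV_deformed ::
    "nat \<Rightarrow> nat \<Rightarrow> (nat \<Rightarrow> nat) \<Rightarrow> nat \<Rightarrow> (gvar, 'a::comm_ring_1) mpoly" where
  "SSV_deformed n k s = SSV_eval n k (\<lambda>j. mvar (Y j))
    (\<lambda>j l. of_bool (l \<in> subset_of_index n (s j)) + mvar (Y 0) * mvar (Z j l))"

lemma msubst_free_coordinates_eq_0_iff:
  fixes F :: "(nat, 'a::comm_ring_1) mpoly"
  assumes "mvars F \<subseteq> T"
  shows "msubst (free_coordinates T \<alpha>) F = 0 \<longleftrightarrow> F = 0"
proof
  define \<rho> :: "gvar \<Rightarrow> (nat, 'a) mpoly" where
    "\<rho> v = (case v of Z _ i \<Rightarrow> mvar i | Y _ \<Rightarrow> 0)" for v
  have "msubst \<rho> (msubst (free_coordinates T \<alpha>) F) = msubst mvar F"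
    unfolding msubst_msubst using assms
    by (intro msubst_cong) (auto simp: free_coordinates_def \<rho>_def)
  then show "F = 0" if "msubst (free_coordinates T \<alpha>) F = 0"
    using that by simp
qed simp

lemma separation_rank_le_free_coordinates:
  assumes "commutative_roABP N w F" "w \<ge> 1" and T': "T' \<subseteq> T" "T \<subseteq> {1..N}"
    and \<alpha>: "\<And>i. mvars (\<alpha> i) \<subseteq> - range (Z 0)"
  shows "separation_rank_le (Z 0 ` T') w (msubst (free_coordinates T \<alpha>) F)"
proof -
  obtain g h where F: "F = (\<Sum>k<w. g k * h k)"
    and g: "\<And>k. mvars (g k) \<subseteq> T'" and h: "\<And>k. mvars (h k) \<inter> T' = {}"
    using commutative_roABP_factorization[OF assms(1,2) order_trans[OF T']] by blast
  have "mvars (msubst (free_coordinates T \<alpha>) (g k)) \<subseteq> Z 0 ` T'" for k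
    using g[of k] T'(1) by (intro mvars_msubst_subset) (auto simp: free_coordinates_def)
  moreover have "mvars (msubst (free_coordinates T \<alpha>) (h k)) \<subseteq> - Z 0 ` T'" for k
    using h[of k]
    by (intro mvars_msubst_subset) (auto simp: free_coordinates_def dest!: subsetD[OF \<alpha>])
  ultimately show ?thesis
    unfolding F msubst.hom_sum msubst.hom_mult
    by (intro separation_rank_le_sum_mult) (auto simp: disjoint_eq_subset_Compl)
qed

lemma msubst_free_coordinates_Diff:
  assumes "i \<in> T" and \<alpha>: "\<And>i. mvars (\<alpha> i) \<subseteq> - range (Z 0)"
  shows "msubst (free_coordinates (T - {i}) \<alpha>) F =
    msubst (mvar(Z 0 i := \<alpha> i)) (msubst (free_coordinates T \<alpha>) F)"
proof -
  have "msubst (mvar(Z 0 i := \<alpha> i)) (\<alpha> i') = \<alpha> i'" for i'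
    using \<alpha>[of i'] by (intro msubst_mvar_upd_idle) auto
  then show ?thesis
    unfolding msubst_msubst using assms(1)
    by (intro msubst_cong) (simp add: free_coordinates_def)
qed

lemma mvars_SSV_deformed_subset: "mvars (SSV_deformed n k s i) \<subseteq> - range (Z 0)"
  unfolding mvars_subset_iff SSV_deformed_def msubst_SSV_eval
  by (intro SSV_eval_cong) (auto simp: hom_distribs of_bool_def)

lemma zero_outside_SSV_deformed:
  assumes "inj_on s {1..k}" "s ` {1..k} \<subseteq> {1..2 ^ n}" "j \<in> {1..k}"
  shows "zero_outside (- {Y 0}) (SSV_deformed n k s (s j)) =
    (mvar (Y j) :: (gvar, 'a::comm_ring_1) mpoly)"
proof -
  have "zero_outside (- {Y 0}) (SSV_deformed n k s (s j)) =
      (SSV_eval n k (\<lambda>j. mvar (Y j)) (\<lambda>j l. of_bool (l \<in> subset_of_index n (s j))) (s j) ::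
        (gvar, 'a) mpoly)"
    unfolding SSV_deformed_def msubst_SSV_eval
    by (intro SSV_eval_cong) (auto simp: hom_distribs of_bool_def)
  also have "\<dots> = (\<Sum>j'\<in>{j' \<in> {1..k}. s j' = s j}. mvar (Y j'))"
    using assms(2,3) by (intro SSV_eval_indicators) blast+
  also have "{j' \<in> {1..k}. s j' = s j} = {j}"
    using assms(1,3) by (auto dest: inj_onD)
  finally show ?thesis
    by simp
qed

lemma msubst_SSV_deformed_eq_0_iff:
  fixes F :: "(nat, 'a::comm_ring_1) mpoly"
  shows "msubst (free_coordinates T (SSV_deformed n k s)) F = 0 \<longleftrightarrow>
    msubst (free_coordinates T (SSV_gen n k)) F = 0"
proof -
  let ?ind = "\<lambda>j l. of_bool (l \<in> subset_of_index n (s j)) :: (gvar, 'a) mpoly"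
  define \<phi> where "\<phi> v = (case v of Y j \<Rightarrow> mvar (Y j)
    | Z j l \<Rightarrow> if j = 0 then mvar (Z j l) else ?ind j l + mvar (Y 0) * mvar (Z j l))" for v
  define \<psi> where "\<psi> v = (case v of Y j \<Rightarrow> if j = 0 then 1 else mvar (Y j)
    | Z j l \<Rightarrow> if j = 0 then mvar (Z j l) else mvar (Z j l) - ?ind j l)" for v
  have "msubst \<phi> (SSV_gen n k i) = SSV_deformed n k s i" for i
    unfolding SSV_gen_eq_SSV_eval SSV_deformed_def msubst_SSV_eval
    by (intro SSV_eval_cong) (auto simp: \<phi>_def)
  then have "msubst \<phi> (free_coordinates T (SSV_gen n k) i) =
      free_coordinates T (SSV_deformed n k s) i" for i
    by (simp add: free_coordinates_def \<phi>_def)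
  moreover have "msubst \<psi> (SSV_deformed n k s i) = SSV_gen n k i" for i
    unfolding SSV_gen_eq_SSV_eval SSV_deformed_def msubst_SSV_eval
    by (intro SSV_eval_cong) (auto simp: \<psi>_def hom_distribs of_bool_def)
  then have "msubst \<psi> (free_coordinates T (SSV_deformed n k s) i) =
      free_coordinates T (SSV_gen n k) i" for i
    by (simp add: free_coordinates_def \<psi>_def)
  ultimately show ?thesis
    by (metis msubst_msubst msubst.hom_zero ext)
qed

lemma two_power_card_le_of_minimal_free_coordinates:
  fixes F :: "(nat, 'a::idom) mpoly"
  assumes roABP: "commutative_roABP (2 ^ n) w F" "w \<ge> 1"
    and T': "T' \<subseteq> T" "T \<subseteq> {1..2 ^ n}"
    and nonzero: "msubst (free_coordinates T (SSV_gen n (card T'))) F \<noteq> 0"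
    and minimal: "\<And>i. i \<in> T \<Longrightarrow> msubst (free_coordinates (T - {i}) (SSV_gen n (card T'))) F = 0"
  shows "2 ^ card T' \<le> w"
proof -
  have "finite T'"
    using T' finite_subset by (metis finite_atLeastAtMost)
  then obtain s where s: "bij_betw s {1..card T'} T'"
    using ex_bij_betw_nat_finite_1 by blast
  then have inj: "inj_on s {1..card T'}" and image: "s ` {1..card T'} = T'"
    by (auto simp: bij_betw_def)
  let ?I = "{1..card T'}" and ?x = "\<lambda>j. Z 0 (s j)"
  let ?\<alpha> = "SSV_deformed n (card T') s :: nat \<Rightarrow> (gvar, 'a) mpoly"
  let ?P = "msubst (free_coordinates T ?\<alpha>) F"
  have "?x ` ?I = Z 0 ` T'"
    using image by (simp add: image_image[of "Z 0" s, symmetric])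
  then have rank: "separation_rank_le (?x ` ?I) w ?P"
    using separation_rank_le_free_coordinates[OF roABP T' mvars_SSV_deformed_subset] by simp
  have vanish: "msubst (mvar(?x j := ?\<alpha> (s j))) ?P = 0" if "j \<in> ?I" for j
  proof -
    have "s j \<in> T"
      using that image T'(1) by blast
    then show ?thesis
      using minimal
      by (simp add: msubst_SSV_deformed_eq_0_iff mvars_SSV_deformed_subset
          flip: msubst_free_coordinates_Diff)
  qed
  have "?P \<noteq> 0"
    using nonzero by (simp add: msubst_SSV_deformed_eq_0_iff)
  have deform: "zero_outside (- {Y 0}) (?\<alpha> (s j)) = mvar (Y j)" if "j \<in> ?I" for j
    using inj image T' that by (intro zero_outside_SSV_deformed) auto
  have "inj_on ?x ?I"
    by (rule inj_onI) (auto dest: inj_onD[OF inj])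
  then have "2 ^ card ?I \<le> w"
    by (rule two_power_card_le_of_vanishing_on_deformed_diagonals
        [OF \<open>?P \<noteq> 0\<close> rank _ _ _ _ _ vanish deform, rotated]) (auto intro: inj_onI)
  then show ?thesis
    by simp
qed

lemma commutative_roABP_hit_by_SSV_gen:
  fixes F :: "(nat, 'a::idom) mpoly"
  assumes "commutative_roABP (2 ^ n) w F" "w \<ge> 1" "w < 2 ^ Suc l" "F \<noteq> 0"
  shows "msubst (SSV_gen n (Suc l + l)) F \<noteq> (0 :: (gvar, 'a) mpoly)"
proof
  assume zero: "msubst (SSV_gen n (Suc l + l)) F = (0 :: (gvar, 'a) mpoly)"
  let ?B = "{1..2 ^ n}"
  have vars: "mvars F \<subseteq> ?B"
    using assms(1,2) by (rule commutative_roABP_mvars_subset)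
  define P where "P T = msubst (free_coordinates T (SSV_gen n (Suc l))) F" for T
  have "?B \<in> {T \<in> Pow ?B. P T \<noteq> 0}"
    using \<open>F \<noteq> 0\<close> msubst_free_coordinates_eq_0_iff[OF vars] unfolding P_def by blast
  then obtain T where T: "T \<subseteq> ?B" "P T \<noteq> 0"
    and "\<forall>U \<in> {T \<in> Pow ?B. P T \<noteq> 0}. U \<subseteq> T \<longrightarrow> T = U"
    using finite_has_minimal2[of "{T \<in> Pow ?B. P T \<noteq> 0}" ?B] by auto
  then have minimal: "P (T - {i}) = 0" if "i \<in> T" for i
    using that by blast
  have "\<not> card T \<le> l"
    using msubst_SSV_gen_replace_coordinates_eq_0[OF zero vars T(1), of "\<lambda>i. mvar (Z 0 i)"] T(2)
    by (auto simp: P_def free_coordinates_def)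
  then obtain T' where T': "T' \<subseteq> T" "card T' = Suc l"
    using obtain_subset_with_card_n[of "Suc l" T] by auto
  then have "2 ^ card T' \<le> w"
    using T minimal unfolding P_def
    by (intro two_power_card_le_of_minimal_free_coordinates[OF assms(1,2) T'(1)]) auto
  with \<open>w < 2 ^ Suc l\<close> T'(2) show False
    by simp
qed

theorem theorem5p19:
  fixes n w d :: nat and F :: "(nat, 'a::field) mpoly"
  assumes "n \<ge> 1" and "w \<ge> 1" and "d \<ge> 1"
    and "infinite (UNIV :: 'a set) \<or> card (UNIV :: 'a set) > n * d"
    and "indiv_deg_le F d"
    and "commutative_roABP (2 ^ n) w F"
  shows "F \<noteq> 0 \<longleftrightarrow>
         msubst (SSV_gen n (1 + 4 * nat \<lceil>log 2 (real w)\<rceil>)) F \<noteq> (0 :: (gvar, 'a) mpoly)"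
proof
  assume "F \<noteq> 0"
  define L where "L = nat \<lceil>log 2 (real w)\<rceil>"
  have "w \<le> 2 ^ L"
    using less_log2_of_power[of L w] real_nat_ceiling_ge[of "log 2 (real w)"]
    by (fastforce simp: L_def not_less[symmetric])
  also have "(2 :: nat) ^ L < 2 ^ Suc (2 * L)"
    by (intro power_strict_increasing) auto
  finally have "msubst (SSV_gen n (Suc (2 * L) + 2 * L)) F \<noteq> (0 :: (gvar, 'a) mpoly)"
    using commutative_roABP_hit_by_SSV_gen[OF assms(6,2)] \<open>F \<noteq> 0\<close> by blast
  also have "Suc (2 * L) + 2 * L = 1 + 4 * L"
    by simp
  finally show "msubst (SSV_gen n (1 + 4 * nat \<lceil>log 2 (real w)\<rceil>)) F \<noteq> (0 :: (gvar, 'a) mpoly)"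
    unfolding L_def .
qed auto

end
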